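(* Let $G$ be a weighted multigraph with vertex set $\{1,\ldots,n\}$. For all $i,j=1,\ldots,n$ the limits $d^{\infty}_{ij}=\lim_{\alpha\to\infty}d^{\alpha}_{ij}$ and $\rho^{\infty}_{ij}=\lim_{\alpha\to\infty}\rho^{\alpha}_{ij}$ always exist (in the latter case, on the extended real line), and $$d^{\infty}_{ij}=\begin{cases}0, & j\in V_i,\\ \frac12\left(\frac{1}{|V_i|}+\frac{1}{|V_j|}\right), & j\notin V_i,\end{cases}$$ $$\rho^{\infty}_{ij}=\widetilde{\rho}_{ij},\qquad i,j=1,\ldots,n,$$ where $V_i$ is the vertex set of the component of $G$ containing $i$ and $\widetilde{\rho}$ is the resistance metric of $G$.
   Context: A weighted multigraph $G$ has finite vertex set $V(G)=\{1,\ldots,n\}$; multiple edges are allowed, loops are not, and all edge weights are strictly positive. Its Laplacian matrix $L=L(G)=(\ell_{ij})$ is given by: for $j\ne i$, $\ell_{ij}$ is minus the sum of the weights of all edges with terminal vertices $i$ and $j$; and $\ell_{ii}=-\sum_{j\neq i}\ell_{ij}$. For a parameter $\alpha>0$, the relative forest accessibility matrix is $Q_\alpha=(q^{\alpha}_{ij})=(I+\alpha L)^{-1}$, the forest distance is $d^{\alpha}_{ij}=\frac12(q^{\alpha}_{ii}+q^{\alpha}_{jj}-q^{\alpha}_{ij}-q^{\alpha}_{ji})$, and the adjusted forest distance is $\rho^{\alpha}_{ij}=\alpha(q^{\alpha}_{ii}+q^{\alpha}_{jj}-q^{\alpha}_{ij}-q^{\alpha}_{ji})$. The resistance metric $\widetilde{\rho}$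 of $G$ takes values in $\mathbb{R}\cup\{+\infty\}$: if $i$ and $j$ belong to different components of $G$, then $\widetilde{\rho}_{ij}=+\infty$; otherwise $\widetilde{\rho}_{ij}=\ell^{+}_{ii}+\ell^{+}_{jj}-\ell^{+}_{ij}-\ell^{+}_{ji}$, where $\ell^{+}_{ij}$ are the entries of the Moore--Penrose generalized inverse $L^{+}$ of $L$. *)

theory Defs
  imports "HOL-Analysis.Analysis"
begin

text \<open>
  The vertex set is the whole finite type \<open>'v\<close>, so \<open>n = CARD('v)\<close>.
  Edges are elements of an arbitrary type and carry their unordered pair of terminal
  vertices, hence distinct edges may be parallel.
\<close>

record ('v, 'e) multigraph =
  edges :: "'e set"
  ends :: "'e \<Rightarrow> 'v set"
  weight :: "'e \<Rightarrow> real"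

definition weighted_multigraph :: "('v::finite, 'e) multigraph \<Rightarrow> bool" where
  "weighted_multigraph G \<longleftrightarrow>
     finite (edges G) \<and> (\<forall>e\<in>edges G. card (ends G e) = 2 \<and> weight G e > 0)"

definition adjacent :: "('v::finite, 'e) multigraph \<Rightarrow> 'v \<Rightarrow> 'v \<Rightarrow> bool" where
  "adjacent G i j \<longleftrightarrow> (\<exists>e\<in>edges G. ends G e = {i, j})"

definition component_of :: "('v::finite, 'e) multigraph \<Rightarrow> 'v \<Rightarrow> 'v set" where
  "component_of G i = {j. (adjacent G)\<^sup>*\<^sup>* i j}"

text \<open>The off-diagonal Laplacian entries; only used for \<open>i \<noteq> j\<close>.\<close>

definition laplacian_offdiag :: "('v::finite, 'e) multigraph \<Rightarrow> 'v \<Rightarrow> 'v \<Rightarrow> real" where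
  "laplacian_offdiag G i j = - (\<Sum>e | e \<in> edges G \<and> ends G e = {i, j}. weight G e)"

definition laplacian :: "('v::finite, 'e) multigraph \<Rightarrow> real^'v^'v" where
  "laplacian G = (\<chi> i j. if i = j then - (\<Sum>k\<in>UNIV - {i}. laplacian_offdiag G i k)
                         else laplacian_offdiag G i j)"

definition forest_matrix :: "('v::finite, 'e) multigraph \<Rightarrow> real \<Rightarrow> real^'v^'v" where
  "forest_matrix G \<alpha> = matrix_inv (mat 1 + \<alpha> *\<^sub>R laplacian G)"

definition forest_distance ::
    "('v::finite, 'e) multigraph \<Rightarrow> real \<Rightarrow> 'v \<Rightarrow> 'v \<Rightarrow> real" where
  "forest_distance G \<alpha> i j = (let Q = forest_matrix G \<alpha> in
     1/2 * (Q$i$i + Q$j$j - Q$i$j - Q$j$i))"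

definition adjusted_forest_distance ::
    "('v::finite, 'e) multigraph \<Rightarrow> real \<Rightarrow> 'v \<Rightarrow> 'v \<Rightarrow> real" where
  "adjusted_forest_distance G \<alpha> i j = (let Q = forest_matrix G \<alpha> in
     \<alpha> * (Q$i$i + Q$j$j - Q$i$j - Q$j$i))"

text \<open>The four Penrose equations; over the reals the adjoint is the transpose.\<close>

definition is_moore_penrose :: "real^'n^'m \<Rightarrow> real^'m^'n \<Rightarrow> bool" where
  "is_moore_penrose A X \<longleftrightarrow>
     A ** X ** A = A \<and> X ** A ** X = X \<and>
     transpose (A ** X) = A ** X \<and> transpose (X ** A) = X ** A"

definition moore_penrose_inv :: "real^'n^'m \<Rightarrow> real^'m^'n" where
  "moore_penrose_inv A = (THE X. is_moore_penrose A X)"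

definition resistance_metric ::
    "('v::finite, 'e) multigraph \<Rightarrow> 'v \<Rightarrow> 'v \<Rightarrow> ereal" where
  "resistance_metric G i j =
     (if j \<in> component_of G i
      then let P = moore_penrose_inv (laplacian G) in
           ereal (P$i$i + P$j$j - P$i$j - P$j$i)
      else \<infinity>)"

end

theory Submission
  imports Defs
begin

text \<open>
  Let \<open>J\<close> be the matrix that averages a vector over each component of \<open>G\<close>, i.e. the orthogonal
  projection onto the kernel of \<open>L\<close>. Then \<open>L + J\<close> is invertible and \<open>X = (L + J)\<^sup>-\<^sup>1 - J\<close> is
  the Moore--Penrose inverse of \<open>L\<close>. For \<open>q = Q\<^sub>\<alpha> v\<close> the equation \<open>q + \<alpha> L q = v\<close> gives
  \<open>\<alpha> (q - J v) = X (v - q)\<close>, and positive semidefiniteness of \<open>L\<close> gives \<open>\<bar>q\<bar> \<le> \<bar>v\<bar>\<close>.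
  Hence \<open>q \<longlongrightarrow> J v\<close> and then \<open>\<alpha> (q - J v) \<longlongrightarrow> X v - X J v = X v\<close>. For \<open>i\<close> and \<open>j\<close>
  in one component the contributions of \<open>J\<close> to \<open>\<rho>\<^sub>i\<^sub>j\<close> cancel; otherwise they add up to
  \<open>1/|V\<^sub>i| + 1/|V\<^sub>j|\<close>, which the factor \<open>\<alpha>\<close> sends to infinity.
\<close>

section \<open>Matrix algebra and the Moore--Penrose inverse\<close>

lemma matrix_add_rdistrib: "(A + B) ** C = A ** C + B ** C"
  by (simp add: matrix_matrix_mult_def vec_eq_iff sum.distrib distrib_right)

lemma matrix_diff_ldistrib: "A ** (B - C) = A ** B - A ** (C :: 'a::ring_1^'p^'n)"
  by (simp add: matrix_matrix_mult_def vec_eq_iff sum_subtractf right_diff_distrib)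

lemma matrix_diff_rdistrib: "(A - B) ** C = A ** C - B ** (C :: 'a::ring_1^'p^'n)"
  by (simp add: matrix_matrix_mult_def vec_eq_iff sum_subtractf left_diff_distrib)

lemma matrix_inv_right: "invertible A \<Longrightarrow> A ** matrix_inv A = mat 1"
  unfolding invertible_def matrix_inv_def by (metis (mono_tags, lifting) someI_ex)

text \<open>\<open>A ** X\<close> and \<open>A ** Y\<close> are symmetric idempotents with the range
  of \<open>A\<close>, hence the same orthogonal projection; likewise \<open>X ** A\<close> and
  \<open>Y ** A\<close>, which share the kernel of \<open>A\<close>. Then
  \<open>X = X ** A ** X = Y ** A ** Y = Y\<close>.\<close>

lemma is_moore_penrose_unique:
  assumes "is_moore_penrose A X" and "is_moore_penrose A Y"
  shows "X = Y"
proof -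
  have X: "A ** X ** A = A" "X ** A ** X = X" "transpose (A ** X) = A ** X"
      "transpose (X ** A) = X ** A"
    and Y: "A ** Y ** A = A" "Y ** A ** Y = Y" "transpose (A ** Y) = A ** Y"
      "transpose (Y ** A) = Y ** A"
    using assms by (auto simp: is_moore_penrose_def)
  have AXAY: "(A ** X) ** (A ** Y) = A ** Y" "(A ** Y) ** (A ** X) = A ** X"
    using X(1) Y(1) by (metis matrix_mul_assoc)+
  have "A ** X = transpose ((A ** Y) ** (A ** X))"
    using AXAY(2) X(3) by simp
  also have "\<dots> = (A ** X) ** (A ** Y)"
    by (simp add: matrix_transpose_mul [of "A ** Y"] X(3) Y(3))
  finally have AX: "A ** X = A ** Y"
    using AXAY(1) by simp
  have XAYA: "(X ** A) ** (Y ** A) = X ** A" "(Y ** A) ** (X ** A) = Y ** A"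
    using X(1) Y(1) by (metis matrix_mul_assoc)+
  have "X ** A = transpose ((X ** A) ** (Y ** A))"
    using XAYA(1) X(4) by simp
  also have "\<dots> = (Y ** A) ** (X ** A)"
    by (simp add: matrix_transpose_mul [of "X ** A"] X(4) Y(4))
  finally have XA: "X ** A = Y ** A"
    using XAYA(2) by simp
  have "X = X ** A ** X" using X(2) by simp
  also have "\<dots> = Y ** (A ** X)" by (simp add: XA matrix_mul_assoc)
  also have "\<dots> = Y" by (simp add: AX Y(2) matrix_mul_assoc)
  finally show ?thesis .
qed

lemma moore_penrose_inv_eq: "is_moore_penrose A X \<Longrightarrow> moore_penrose_inv A = X"
  unfolding moore_penrose_inv_def by (blast intro: is_moore_penrose_unique)

section \<open>Asymptotics of the resolvent\<close>

lemma matrix_vector_mult_axis_nth: "((A :: real^'n^'m) *v axis j 1) $ i = A $ i $ j"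
  by (simp add: matrix_vector_mult_basis column_def)

text \<open>A bootstrap: a bound on \<open>q v \<alpha>\<close> makes
  \<open>q v \<alpha> - J *v v\<close> of order 1/\<alpha>, and this first limit, put back into the
  same identity, yields the second.\<close>

lemma resolvent_tendsto:
  fixes L J X :: "real^'n^'n"
  assumes psd: "\<And>x. 0 \<le> x \<bullet> (L *v x)"
    and XL: "X ** L = mat 1 - J" and JL: "J ** L = 0" and XJ: "X ** J = 0"
  defines "q \<equiv> \<lambda>v \<alpha>. matrix_inv (mat 1 + \<alpha> *\<^sub>R L) *v v"
  shows "(q v \<longlongrightarrow> J *v v) at_top"
    and "((\<lambda>\<alpha>. \<alpha> *\<^sub>R (q v \<alpha> - J *v v)) \<longlongrightarrow> X *v v) at_top"
proof -
  have inv: "invertible (mat 1 + \<alpha> *\<^sub>R L)" if "\<alpha> > 0" for \<alpha> :: real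
  proof -
    have "x = 0" if x: "(mat 1 + \<alpha> *\<^sub>R L) *v x = 0" for x
    proof -
      have "x \<bullet> x + \<alpha> * (x \<bullet> (L *v x)) = x \<bullet> ((mat 1 + \<alpha> *\<^sub>R L) *v x)"
        by (simp add: matrix_vector_mult_add_rdistrib scaleR_matrix_vector_assoc [symmetric]
            inner_add_right)
      also have "\<dots> = 0" using x by simp
      finally show ?thesis
        using psd[of x] \<open>\<alpha> > 0\<close> by (smt (verit) inner_gt_zero_iff mult_nonneg_nonneg)
    qed
    then show ?thesis
      by (simp add: invertible_left_inverse matrix_left_invertible_ker)
  qed
  have q: "q v \<alpha> + \<alpha> *\<^sub>R (L *v q v \<alpha>) = v" if "\<alpha> > 0" for \<alpha>
  proof -
    have "(mat 1 + \<alpha> *\<^sub>R L) *v q v \<alpha> = v"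
      unfolding q_def by (simp add: matrix_vector_mul_assoc matrix_inv_right inv that)
    then show ?thesis
      by (simp add: matrix_vector_mult_add_rdistrib scaleR_matrix_vector_assoc [symmetric])
  qed
  \<comment> \<open>Pair the equation with \<open>q v \<alpha>\<close> and use that the
    \<open>L\<close> term is nonnegative; after Cauchy--Schwarz the common factor cancels, unless
    \<open>q v \<alpha> = 0\<close>, where the bound is trivial.\<close>
  have q_le: "norm (q v \<alpha>) \<le> norm v" if "\<alpha> > 0" for \<alpha>
  proof -
    have "norm (q v \<alpha>) * norm (q v \<alpha>) \<le> q v \<alpha> \<bullet> q v \<alpha> + \<alpha> * (q v \<alpha> \<bullet> (L *v q v \<alpha>))"
      using psd[of "q v \<alpha>"] that by (simp add: dot_square_norm power2_eq_square)
    also have "\<dots> = q v \<alpha> \<bullet> v"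
      using q[OF that] by (metis inner_add_right inner_scaleR_right)
    also have "\<dots> \<le> norm (q v \<alpha>) * norm v"
      by (rule norm_cauchy_schwarz)
    finally show ?thesis
      by (metis mult_le_cancel_left_pos norm_ge_zero order_le_less)
  qed
  \<comment> \<open>Since \<open>J ** L = 0\<close>, \<open>J *v v = J *v q v \<alpha>\<close>, so
    the difference on the left is \<open>(mat 1 - J) *v q v \<alpha>\<close>, that is
    \<open>(X ** L) *v q v \<alpha>\<close>.\<close>
  have key: "\<alpha> *\<^sub>R (q v \<alpha> - J *v v) = X *v (v - q v \<alpha>)" if "\<alpha> > 0" for \<alpha>
  proof -
    have "J *v v = J *v (q v \<alpha> + \<alpha> *\<^sub>R (L *v q v \<alpha>))"
      using q[OF that] by simp
    also have "\<dots> = J *v q v \<alpha>"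
      by (simp add: matrix_vector_right_distrib matrix_vector_mult_scaleR matrix_vector_mul_assoc JL)
    finally have Jq: "J *v v = J *v q v \<alpha>" .
    have "v - q v \<alpha> = \<alpha> *\<^sub>R (L *v q v \<alpha>)"
      using q[OF that] by (simp add: algebra_simps)
    then have "X *v (v - q v \<alpha>) = \<alpha> *\<^sub>R ((X ** L) *v q v \<alpha>)"
      by (simp add: matrix_vector_mult_scaleR matrix_vector_mul_assoc)
    then show ?thesis
      by (simp add: XL Jq matrix_vector_mult_diff_rdistrib)
  qed
  obtain K where K: "K > 0" "\<And>x. norm (X *v x) \<le> norm x * K"
    using bounded_linear.pos_bounded[OF matrix_vector_mul_bounded_linear[of X]] by blast
  \<comment> \<open>\<open>K\<close> bounds the operator \<open>X\<close>; the factor 2 comes from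
    the triangle inequality for \<open>v - q v \<alpha>\<close> and \<open>q_le\<close>.\<close>
  have "norm (q v \<alpha> - J *v v) \<le> 2 * norm v * K / \<alpha>" if "\<alpha> > 0" for \<alpha>
  proof -
    have "\<alpha> * norm (q v \<alpha> - J *v v) = norm (X *v (v - q v \<alpha>))"
      using key[OF that, symmetric] that by simp
    also have "\<dots> \<le> norm (v - q v \<alpha>) * K" by (rule K)
    also have "\<dots> \<le> (2 * norm v) * K"
      using q_le[OF that] norm_triangle_ineq4[of v "q v \<alpha>"] K(1) by (intro mult_right_mono) auto
    finally show ?thesis using that by (simp add: field_simps)
  qed
  then have "eventually (\<lambda>\<alpha>. norm (q v \<alpha> - J *v v) \<le> 2 * norm v * K / \<alpha>) at_top"
    using eventually_gt_at_top[of 0] by (rule eventually_mono[rotated])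
  moreover have "((\<lambda>\<alpha>. 2 * norm v * K / \<alpha>) \<longlongrightarrow> 0) at_top"
    by (intro tendsto_divide_0[OF tendsto_const] filterlim_at_top_imp_at_infinity filterlim_ident)
  ultimately have "((\<lambda>\<alpha>. q v \<alpha> - J *v v) \<longlongrightarrow> 0) at_top"
    by (rule Lim_null_comparison)
  then show lim: "(q v \<longlongrightarrow> J *v v) at_top"
    by (simp add: LIM_zero_iff)
  have "((\<lambda>\<alpha>. X *v (v - q v \<alpha>)) \<longlongrightarrow> X *v (v - J *v v)) at_top"
    by (intro bounded_linear.tendsto[OF matrix_vector_mul_bounded_linear] tendsto_diff
        tendsto_const lim)
  moreover have "X *v (v - J *v v) = X *v v"
    by (simp add: matrix_vector_mult_diff_distrib matrix_vector_mul_assoc XJ)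
  moreover have "eventually (\<lambda>\<alpha>. X *v (v - q v \<alpha>) = \<alpha> *\<^sub>R (q v \<alpha> - J *v v)) at_top"
    using eventually_gt_at_top[of 0] by eventually_elim (simp add: key)
  ultimately show "((\<lambda>\<alpha>. \<alpha> *\<^sub>R (q v \<alpha> - J *v v)) \<longlongrightarrow> X *v v) at_top"
    by (simp add: tendsto_cong)
qed

section \<open>Laplacian entries, quadratic form and positivity\<close>

lemma adjacent_commute: "adjacent G i j \<longleftrightarrow> adjacent G j i"
  by (simp add: adjacent_def insert_commute)

lemma laplacian_offdiag_commute: "laplacian_offdiag G i j = laplacian_offdiag G j i"
  by (simp add: laplacian_offdiag_def insert_commute)

lemma laplacian_offdiag_nonpos: "weighted_multigraph G \<Longrightarrow> laplacian_offdiag G i j \<le> 0"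
  unfolding laplacian_offdiag_def weighted_multigraph_def neg_le_0_iff_le
  by (rule sum_nonneg) (auto intro: less_imp_le)

text \<open>Positive weights cannot cancel, so the sum vanishes only over an empty set of
  edges.\<close>

lemma laplacian_offdiag_eq_0_iff:
  assumes "weighted_multigraph G"
  shows "laplacian_offdiag G i j = 0 \<longleftrightarrow> \<not> adjacent G i j"
proof -
  have "laplacian_offdiag G i j = 0 \<longleftrightarrow>
      (\<forall>e\<in>{e \<in> edges G. ends G e = {i, j}}. weight G e = 0)"
    using assms unfolding laplacian_offdiag_def neg_equal_0_iff_equal
    by (intro sum_nonneg_eq_0_iff) (auto simp: weighted_multigraph_def less_imp_le)
  also have "\<dots> \<longleftrightarrow> \<not> adjacent G i j"
    using assms by (force simp: adjacent_def weighted_multigraph_def)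
  finally show ?thesis .
qed

lemma transpose_laplacian: "transpose (laplacian G) = laplacian G"
  by (simp add: transpose_def laplacian_def vec_eq_iff laplacian_offdiag_commute)

text \<open>Zero row sums turn each row into weighted differences. The index \<open>k = i\<close>
  may be included because its factor \<open>x $ i - x $ i\<close> is zero.\<close>

lemma laplacian_mult_nth:
  "(laplacian G *v x) $ i = (\<Sum>k\<in>UNIV. laplacian_offdiag G i k * (x $ k - x $ i))"
proof -
  have "(laplacian G *v x) $ i =
      (\<Sum>k\<in>UNIV - {i}. laplacian G $ i $ k * x $ k) + laplacian G $ i $ i * x $ i"
    by (simp add: matrix_vector_mult_def sum.remove[of UNIV i])
  also have "\<dots> = (\<Sum>k\<in>UNIV - {i}. laplacian_offdiag G i k * x $ k) -
      (\<Sum>k\<in>UNIV - {i}. laplacian_offdiag G i k) * x $ i"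
    by (simp add: laplacian_def)
  also have "\<dots> = (\<Sum>k\<in>UNIV - {i}. laplacian_offdiag G i k * (x $ k - x $ i))"
    by (simp add: sum_distrib_right right_diff_distrib sum_subtractf)
  also have "\<dots> = (\<Sum>k\<in>UNIV. laplacian_offdiag G i k * (x $ k - x $ i))"
    by (simp add: sum.remove[of UNIV i])
  finally show ?thesis .
qed

text \<open>The Dirichlet energy of \<open>x\<close>. Symmetry of the weights allows the two indices
  to be exchanged; adding the double sum to its exchanged copy produces the squares, hence the
  factor 2.\<close>

lemma laplacian_quadratic_form:
  "2 * (x \<bullet> (laplacian G *v x)) =
     (\<Sum>i\<in>UNIV. \<Sum>k\<in>UNIV. - laplacian_offdiag G i k * (x $ i - x $ k)\<^sup>2)"
proof -
  let ?w = "laplacian_offdiag G"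
  have 1: "x \<bullet> (laplacian G *v x) = (\<Sum>i\<in>UNIV. \<Sum>k\<in>UNIV. ?w i k * (x $ k - x $ i) * x $ i)"
    by (simp add: inner_vec_def laplacian_mult_nth sum_distrib_left mult_ac)
  also have "\<dots> = (\<Sum>i\<in>UNIV. \<Sum>k\<in>UNIV. ?w i k * (x $ i - x $ k) * x $ k)"
    by (subst sum.swap) (simp add: laplacian_offdiag_commute)
  finally have 2: "x \<bullet> (laplacian G *v x) = \<dots>" .
  have "2 * (x \<bullet> (laplacian G *v x)) =
      (\<Sum>i\<in>UNIV. \<Sum>k\<in>UNIV. ?w i k * (x $ k - x $ i) * x $ i + ?w i k * (x $ i - x $ k) * x $ k)"
    unfolding sum.distrib using 1 2 by linarith
  also have "\<dots> = (\<Sum>i\<in>UNIV. \<Sum>k\<in>UNIV. - ?w i k * (x $ i - x $ k)\<^sup>2)"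
    by (intro sum.cong refl) (simp add: algebra_simps power2_eq_square)
  finally show ?thesis .
qed

lemma laplacian_psd:
  assumes "weighted_multigraph G"
  shows "0 \<le> x \<bullet> (laplacian G *v x)"
proof -
  have "0 \<le> 2 * (x \<bullet> (laplacian G *v x))"
    unfolding laplacian_quadratic_form
    by (intro sum_nonneg mult_nonneg_nonneg) (simp_all add: laplacian_offdiag_nonpos assms)
  then show ?thesis by simp
qed

section \<open>Components and the kernel of the Laplacian\<close>

lemma component_of_refl: "i \<in> component_of G i"
  by (simp add: component_of_def)

lemma component_of_eq:
  assumes "j \<in> component_of G i"
  shows "component_of G j = component_of G i"
proof -
  have "symp (adjacent G)"
    by (auto simp: symp_def adjacent_commute)
  then have "symp (adjacent G)\<^sup>*\<^sup>*"
    by (rule symp_rtranclp)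
  then show ?thesis
    using assms by (auto simp: component_of_def symp_def intro: rtranclp_trans)
qed

lemma component_of_commute: "j \<in> component_of G i \<longleftrightarrow> i \<in> component_of G j"
  using component_of_eq component_of_refl by blast

text \<open>Zero energy forces every nonnegative summand to vanish, so \<open>x\<close> agrees
  across each edge and, by induction, along each path. Conversely, each row only sees differences
  across edges, which are then zero.\<close>

lemma laplacian_ker:
  assumes G: "weighted_multigraph G"
  shows "laplacian G *v x = 0 \<longleftrightarrow> (\<forall>i. \<forall>j\<in>component_of G i. x $ j = x $ i)"
proof
  assume "laplacian G *v x = 0"
  then have "(\<Sum>i\<in>UNIV. \<Sum>k\<in>UNIV. - laplacian_offdiag G i k * (x $ i - x $ k)\<^sup>2) = 0"
    using laplacian_quadratic_form[of x G] by simp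
  then have "- laplacian_offdiag G i k * (x $ i - x $ k)\<^sup>2 = 0" for i k
    by (simp add: sum_nonneg_eq_0_iff sum_nonneg mult_nonpos_nonneg laplacian_offdiag_nonpos[OF G])
  then have adj: "x $ i = x $ k" if "adjacent G i k" for i k
    using that laplacian_offdiag_eq_0_iff[OF G, of i k] by (metis mult_eq_0_iff neg_equal_0_iff_equal
        power_eq_0_iff right_minus_eq)
  have "x $ j = x $ i" if "(adjacent G)\<^sup>*\<^sup>* i j" for i j
    using that by (induction rule: rtranclp_induct) (auto dest: adj)
  then show "\<forall>i. \<forall>j\<in>component_of G i. x $ j = x $ i"
    by (simp add: component_of_def)
next
  assume const: "\<forall>i. \<forall>j\<in>component_of G i. x $ j = x $ i"
  have "laplacian_offdiag G i k * (x $ k - x $ i) = 0" for i k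
  proof (cases "adjacent G i k")
    case True
    then have "k \<in> component_of G i" by (auto simp: component_of_def)
    then show ?thesis using const by simp
  qed (simp add: laplacian_offdiag_eq_0_iff G)
  then show "laplacian G *v x = 0"
    unfolding vec_eq_iff laplacian_mult_nth by (intro allI) (simp only: sum.neutral_const zero_index)
qed

section \<open>Averaging over components and the pseudoinverse of the Laplacian\<close>

definition component_average :: "('v::finite, 'e) multigraph \<Rightarrow> real^'v^'v" where
  "component_average G =
     (\<chi> i j. if j \<in> component_of G i then 1 / real (card (component_of G i)) else 0)"

lemma transpose_component_average: "transpose (component_average G) = component_average G"
  by (auto simp: transpose_def component_average_def vec_eq_iff component_of_commute
      dest: component_of_eq)

lemma component_average_mult_const:
  assumes "\<forall>i. \<forall>j\<in>component_of G i. x $ j = x $ i"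
  shows "component_average G *v x = x"
proof -
  have "(component_average G *v x) $ i = x $ i" for i
  proof -
    have "(component_average G *v x) $ i =
        (\<Sum>j\<in>UNIV. if j \<in> component_of G i then x $ j / real (card (component_of G i)) else 0)"
      by (simp add: component_average_def matrix_vector_mult_def if_distribR cong: if_cong)
        (rule sum.cong, auto)
    also have "\<dots> = (\<Sum>j\<in>component_of G i. x $ i / real (card (component_of G i)))"
      using assms by (simp add: sum.inter_filter[symmetric])
    also have "\<dots> = x $ i"
      using component_of_refl[of i G] by (auto simp: card_eq_0_iff)
    finally show ?thesis .
  qed
  then show ?thesis by (simp add: vec_eq_iff)
qed

text \<open>Vertices of one component have identical rows in
  \<open>component_average G\<close>.\<close>

lemma component_average_mult_is_const:
  "\<forall>i. \<forall>j\<in>component_of G i. (component_average G *v x) $ j = (component_average G *v x) $ i"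
proof (intro allI ballI)
  fix i j assume "j \<in> component_of G i"
  then show "(component_average G *v x) $ j = (component_average G *v x) $ i"
    by (simp add: component_average_def matrix_vector_mult_def component_of_eq cong: if_cong)
qed

lemma component_average_idem: "component_average G ** component_average G = component_average G"
  by (simp add: matrix_eq matrix_vector_mul_assoc [symmetric]
      component_average_mult_const[OF component_average_mult_is_const])

lemma laplacian_component_average:
  assumes "weighted_multigraph G"
  shows "laplacian G ** component_average G = 0"
    and "component_average G ** laplacian G = 0"
proof -
  show LJ: "laplacian G ** component_average G = 0"
    using laplacian_ker[OF assms] component_average_mult_is_const[of G]
    by (simp add: matrix_eq matrix_vector_mul_assoc [symmetric])
  have "component_average G ** laplacian G = transpose (laplacian G ** component_average G)"
    by (simp add: matrix_transpose_mul transpose_laplacian transpose_component_average)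
  then show "component_average G ** laplacian G = 0"
    by (simp add: LJ transpose_def vec_eq_iff)
qed

lemma laplacian_moore_penrose:
  assumes G: "weighted_multigraph G"
  defines "L \<equiv> laplacian G" and "J \<equiv> component_average G"
  defines "X \<equiv> moore_penrose_inv L"
  shows "X ** L = mat 1 - J" and "X ** J = 0"
proof -
  have LJ: "L ** J = 0" and JL: "J ** L = 0"
    using laplacian_component_average[OF G] by (simp_all add: L_def J_def)
  have JJ: "J ** J = J"
    by (simp add: J_def component_average_idem)
  \<comment> \<open>Applying \<open>J\<close> to the equation isolates \<open>J *v x = 0\<close>;
    then \<open>L *v x = 0\<close> makes \<open>x\<close> constant on components, so
    \<open>x = J *v x = 0\<close>.\<close>
  have "x = 0" if x: "(L + J) *v x = 0" for x
  proof -
    have "J *v x = J *v ((L + J) *v x)"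
      by (simp add: matrix_vector_mul_assoc matrix_add_ldistrib JL JJ)
    then have Jx: "J *v x = 0" using x by simp
    then have "L *v x = 0" using x by (simp add: matrix_vector_mult_add_rdistrib)
    then have "J *v x = x"
      using laplacian_ker[OF G] component_average_mult_const by (auto simp: L_def J_def)
    then show ?thesis using Jx by simp
  qed
  then have "invertible (L + J)"
    by (simp add: invertible_left_inverse matrix_left_invertible_ker)
  then obtain M where M: "(L + J) ** M = mat 1" "M ** (L + J) = mat 1"
    by (auto simp: invertible_def)
  have JM: "J ** M = J"
  proof -
    have "J ** M = (J ** (L + J)) ** M" by (simp add: matrix_add_ldistrib JL JJ)
    also have "\<dots> = J" by (simp add: matrix_mul_assoc[symmetric] M)
    finally show ?thesis .
  qed
  have MJ: "M ** J = J"
  proof -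
    have "M ** J = M ** ((L + J) ** J)" by (simp add: matrix_add_rdistrib LJ JJ)
    also have "\<dots> = J" by (simp add: matrix_mul_assoc M)
    finally show ?thesis .
  qed
  \<comment> \<open>\<open>M\<close> is the identity on the range of \<open>J\<close>; subtracting
    \<open>J\<close> makes it zero there and leaves an inverse of \<open>L\<close> modulo
    \<open>J\<close>.\<close>
  define Y where "Y = M - J"
  have LY: "L ** Y = mat 1 - J"
    using M(1) by (simp add: Y_def matrix_diff_ldistrib matrix_add_rdistrib LJ JM algebra_simps)
  have YL: "Y ** L = mat 1 - J"
    using M(2) by (simp add: Y_def matrix_diff_rdistrib matrix_add_ldistrib JL MJ algebra_simps)
  have YJ: "Y ** J = 0"
    by (simp add: Y_def matrix_diff_rdistrib MJ JJ)
  have JY: "J ** Y = 0"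
    by (simp add: Y_def matrix_diff_ldistrib JM JJ)
  \<comment> \<open>Both products of \<open>L\<close> and \<open>Y\<close> equal this projection, so
    its symmetry settles two Penrose equations; the other two follow from \<open>J ** L = 0\<close>
    and \<open>J ** Y = 0\<close>.\<close>
  have "transpose (mat 1 - J) = mat 1 - J"
    using transpose_component_average[of G]
    by (simp add: transpose_def J_def vec_eq_iff mat_def)
  then have "is_moore_penrose L Y"
    by (simp add: is_moore_penrose_def LY YL matrix_diff_rdistrib JL JY)
  then have "X = Y"
    by (simp add: X_def moore_penrose_inv_eq)
  then show "X ** L = mat 1 - J" "X ** J = 0"
    using YL YJ by simp_all
qed

section \<open>Limits of the two distances\<close>

theorem proposition11:
  fixes G :: "('v::finite, 'e) multigraph"
  assumes "weighted_multigraph G"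
  shows "\<forall>i j.
    ((\<lambda>\<alpha>. forest_distance G \<alpha> i j) \<longlongrightarrow>
       (if j \<in> component_of G i then 0
        else 1/2 * (1 / real (card (component_of G i)) + 1 / real (card (component_of G j)))))
      at_top \<and>
    ((\<lambda>\<alpha>. ereal (adjusted_forest_distance G \<alpha> i j)) \<longlongrightarrow> resistance_metric G i j) at_top"
proof (intro allI)
  fix i j :: 'v
  define L where "L = laplacian G"
  define J where "J = component_average G"
  define X where "X = moore_penrose_inv L"
  define D where "D = (\<lambda>A :: real^'v^'v. A$i$i + A$j$j - A$i$j - A$j$i)"
  define Q where "Q = forest_matrix G"
  note mp = laplacian_moore_penrose[OF assms, folded L_def J_def, folded X_def]
  note JL = laplacian_component_average(2)[OF assms, folded L_def J_def]
  note lim = resolvent_tendsto[OF laplacian_psd[OF assms, folded L_def] mp(1) JL mp(2),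
      folded forest_matrix_def[of G, folded L_def] Q_def]
  \<comment> \<open>Applied to \<open>axis l 1\<close>, the resolvent limit describes column
    \<open>l\<close>; its coordinate \<open>k\<close> is a single entry.\<close>
  have "((\<lambda>\<alpha>. Q \<alpha> $ k $ l) \<longlongrightarrow> J $ k $ l) at_top" for k l
    using tendsto_vec_nth[OF lim(1)[of "axis l 1"], of k] by (simp add: matrix_vector_mult_axis_nth)
  then have DQ: "((\<lambda>\<alpha>. D (Q \<alpha>)) \<longlongrightarrow> D J) at_top"
    unfolding D_def by (intro tendsto_add tendsto_diff)
  have "((\<lambda>\<alpha>. \<alpha> * (Q \<alpha> $ k $ l - J $ k $ l)) \<longlongrightarrow> X $ k $ l) at_top" for k l
    using tendsto_vec_nth[OF lim(2)[of "axis l 1"], of k] by (simp add: matrix_vector_mult_axis_nth)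
  then have "((\<lambda>\<alpha>. \<alpha> * (Q \<alpha> $ i $ i - J $ i $ i) + \<alpha> * (Q \<alpha> $ j $ j - J $ j $ j)
      - \<alpha> * (Q \<alpha> $ i $ j - J $ i $ j) - \<alpha> * (Q \<alpha> $ j $ i - J $ j $ i)) \<longlongrightarrow> D X) at_top"
    unfolding D_def by (intro tendsto_add tendsto_diff)
  then have DX: "((\<lambda>\<alpha>. \<alpha> * (D (Q \<alpha>) - D J)) \<longlongrightarrow> D X) at_top"
    by (simp add: D_def algebra_simps)
  \<comment> \<open>Within a component all four entries of \<open>J\<close> equal the reciprocal of
    its size; across components the two mixed entries vanish.\<close>
  have DJ: "D J = (if j \<in> component_of G i then 0
      else 1 / real (card (component_of G i)) + 1 / real (card (component_of G j)))"
    using component_of_eq[of j G i] component_of_commute[of j G i]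
    by (auto simp: D_def J_def component_average_def component_of_refl)
  have "((\<lambda>\<alpha>. forest_distance G \<alpha> i j) \<longlongrightarrow> 1/2 * D J) at_top"
    using tendsto_mult_left[OF DQ, of "1/2"]
    by (simp add: forest_distance_def Let_def D_def Q_def)
  moreover have "adjusted_forest_distance G \<alpha> i j = \<alpha> * D (Q \<alpha>)" for \<alpha>
    by (simp add: adjusted_forest_distance_def Let_def D_def Q_def)
  moreover have "((\<lambda>\<alpha>. ereal (\<alpha> * D (Q \<alpha>))) \<longlongrightarrow> resistance_metric G i j) at_top"
  proof (cases "j \<in> component_of G i")
    case True
    then have "resistance_metric G i j = ereal (D X)"
      by (simp add: resistance_metric_def Let_def D_def X_def L_def)
    then show ?thesis using DX True by (simp add: DJ)
  next
    case False
    \<comment> \<open>Components are nonempty, so \<open>D (Q \<alpha>)\<close> has a positive limit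
      and its product with \<alpha> diverges to infinity.\<close>
    have "0 < card (component_of G k)" for k
      using component_of_refl[of k G] by (auto simp: card_gt_0_iff)
    then have "0 < D J"
      using False by (simp add: DJ add_pos_pos)
    then have "filterlim (\<lambda>\<alpha>. D (Q \<alpha>) * \<alpha>) at_top at_top"
      by (intro filterlim_tendsto_pos_mult_at_top[OF DQ] filterlim_ident)
    then show ?thesis
      using False
      by (simp add: resistance_metric_def tendsto_PInfty_eq_at_top mult.commute)
  qed
  ultimately show "((\<lambda>\<alpha>. forest_distance G \<alpha> i j) \<longlongrightarrow>
       (if j \<in> component_of G i then 0
        else 1/2 * (1 / real (card (component_of G i)) + 1 / real (card (component_of G j)))))
      at_top \<and>
    ((\<lambda>\<alpha>. ereal (adjusted_forest_distance G \<alpha> i j)) \<longlongrightarrow> resistance_metric G i j) at_top"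
    by (simp add: DJ split: if_splits)
qed

end
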